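(* Let $l \ge 2$, let $k_1,\dots,k_l$ be distinct natural numbers, and let $s_1,\dots,s_l$ be natural numbers. For a natural number $N$ let $R^+(N)$ denote the number of solutions of $$\sum_{i=1}^{l}\sum_{j=1}^{s_i} x_{ij}^{k_i} = \sum_{i=1}^{l}\sum_{j=1}^{s_i} y_{ij}^{k_i}$$ in natural numbers $x_{ij}, y_{ij}$ with $1 \le x_{ij}, y_{ij} \le N$. Then $$R^+(N) = \int_0^1 \prod_{i=1}^{l} |f_{k_i}(x)|^{2s_i}\,dx \le \left(\prod_{i=1}^{l-1}\left(\int_0^1 |f_{k_i}(x)|^{2^{i+1}s_i}\,dx\right)^{1/2^{i}}\right)\cdot\left(\int_0^1 |f_{k_l}(x)|^{2^{l}s_l}\,dx\right)^{1/2^{l-1}}.$$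
   Context: Natural numbers are positive integers. For a natural number $k$ (and the given $N$), $f_k(x) = \sum_{m=1}^{N} e^{2\pi i x m^k}$ for real $x$, where in the exponent $i$ denotes the imaginary unit. *)

theory Defs
  imports "HOL-Analysis.Analysis"
begin

definition weyl_sum :: "nat \<Rightarrow> nat \<Rightarrow> real \<Rightarrow> complex" where
  "weyl_sum N k x = (\<Sum>m = 1..N. exp (2 * of_real pi * \<i> * of_real x * of_nat m ^ k))"

text \<open>The families \<open>(x i j)\<close> with \<open>1 \<le> i \<le> l\<close> and \<open>1 \<le> j \<le> s i\<close> are functions on the pairs
  \<open>(i, j)\<close>, taken extensional so that each family is counted exactly once.\<close>

definition solution_set ::
  "nat \<Rightarrow> (nat \<Rightarrow> nat) \<Rightarrow> (nat \<Rightarrow> nat) \<Rightarrow> nat \<Rightarrow> ((nat \<times> nat \<Rightarrow> nat) \<times> (nat \<times> nat \<Rightarrow> nat)) set"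
where
  "solution_set l k s N =
    {(x, y). x \<in> (SIGMA i:{1..l}. {1..s i}) \<rightarrow>\<^sub>E {1..N} \<and>
             y \<in> (SIGMA i:{1..l}. {1..s i}) \<rightarrow>\<^sub>E {1..N} \<and>
             (\<Sum>i = 1..l. \<Sum>j = 1..s i. x (i, j) ^ k i) =
             (\<Sum>i = 1..l. \<Sum>j = 1..s i. y (i, j) ^ k i)}"

definition num_solutions :: "nat \<Rightarrow> (nat \<Rightarrow> nat) \<Rightarrow> (nat \<Rightarrow> nat) \<Rightarrow> nat \<Rightarrow> nat" where
  "num_solutions l k s N = card (solution_set l k s N)"

end

theory Submission
  imports Defs
begin

text \<open>Expanding the product of the powers of the \<open>f\<^bsub>k\<^sub>i\<^esub>\<close> gives one exponential sum over all families
  \<open>x\<close>, and orthogonality of the characters on \<open>[0, 1]\<close> turns the mean square of its modulus into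
  the number of pairs of families with equal frequency. For the inequality, apply Cauchy--Schwarz
  repeatedly, each time splitting off one factor from the product that remains.\<close>

text \<open>Orthogonality of characters: for \<open>n \<noteq> 0\<close> the antiderivative
  \<open>cis (c * x) / (\<i> * c)\<close> takes equal values at 0 and 1, since \<open>c\<close> is a
  multiple of the period of \<open>cis\<close>.\<close>

lemma has_integral_cis_int:
  fixes n :: int
  shows "((\<lambda>x. cis (2 * pi * n * x)) has_integral (if n = 0 then 1 else 0)) {0..1}"
proof (cases "n = 0")
  case True
  have "((\<lambda>x::real. 1::complex) has_integral 1) {0..1}"
    using has_integral_const_real[of "1::complex" 0 1] by simp
  then show ?thesis using True by simp
next
  case False
  define c where "c = 2 * pi * n"
  have c: "c \<noteq> 0" using False by (simp add: c_def)
  have deriv: "((\<lambda>x. cis (c * x) / (\<i> * c)) has_vector_derivative cis (c * x)) (at x within {0..1})" for x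
  proof -
    \<comment> \<open>Differentiate in a complex variable, then restrict to the real line.\<close>
    have "((\<lambda>z. exp (\<i> * c * z) / (\<i> * c)) has_field_derivative exp (\<i> * c * of_real x)) (at (of_real x))"
      by (auto intro!: derivative_eq_intros simp: c)
    from has_vector_derivative_real_field[OF this] show ?thesis
      by (simp add: cis_conv_exp mult.assoc)
  qed
  have "((\<lambda>x. cis (c * x)) has_integral cis (c * 1) / (\<i> * c) - cis (c * 0) / (\<i> * c)) {0..1}"
    by (rule fundamental_theorem_of_calculus) (use deriv in auto)
  moreover have "cis c = 1"
    unfolding c_def by (rule cis_multiple_2pi) simp
  ultimately show ?thesis
    using False by (simp add: c_def)
qed

text \<open>This is \<open>z * cnj z\<close> multiplied out. The frequency differences are taken in
  \<open>int\<close>, where subtraction does not truncate.\<close>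

lemma norm_sum_cis_sq:
  fixes S :: "'a \<Rightarrow> nat" and x :: real
  shows "of_real ((norm (\<Sum>p\<in>P. cis (2 * pi * S p * x)))\<^sup>2) =
    (\<Sum>p\<in>P. \<Sum>q\<in>P. cis (2 * pi * (int (S p) - int (S q)) * x))"
  unfolding complex_norm_square cnj_sum sum_product cis_cnj cis_mult
  by (simp add: algebra_simps)

text \<open>Integrating the double sum termwise, each pair of equal frequencies contributes 1 and
  every other pair 0.\<close>

lemma has_integral_norm_sum_cis_sq:
  fixes S :: "'a \<Rightarrow> nat"
  assumes "finite P"
  shows "((\<lambda>x::real. (norm (\<Sum>p\<in>P. cis (2 * pi * S p * x)))\<^sup>2) has_integral
    real (card {(p, q). p \<in> P \<and> q \<in> P \<and> S p = S q})) {0..1}"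
proof -
  let ?D = "{(p, q). p \<in> P \<and> q \<in> P \<and> S p = S q}"
  have "((\<lambda>x. \<Sum>p\<in>P. \<Sum>q\<in>P. cis (2 * pi * (int (S p) - int (S q)) * x)) has_integral
      (\<Sum>p\<in>P. \<Sum>q\<in>P. if int (S p) - int (S q) = 0 then 1 else 0)) {0..1}"
    using assms by (intro has_integral_sum has_integral_cis_int)
  moreover have "(\<Sum>p\<in>P. \<Sum>q\<in>P. if int (S p) - int (S q) = 0 then 1 else 0 :: complex)
      = of_nat (card ?D)"
  proof -
    have "(\<Sum>p\<in>P. \<Sum>q\<in>P. if int (S p) - int (S q) = 0 then 1 else 0 :: complex)
        = (\<Sum>r\<in>P \<times> P. if r \<in> ?D then 1 else 0)"
      unfolding sum.cartesian_product by (intro sum.cong) (auto split: if_splits)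
    also have "\<dots> = (\<Sum>r\<in>(P \<times> P) \<inter> ?D. 1)"
      using assms by (subst sum.inter_restrict) auto
    also have "(P \<times> P) \<inter> ?D = ?D" by auto
    finally show ?thesis by simp
  qed
  ultimately have "((\<lambda>x. complex_of_real ((norm (\<Sum>p\<in>P. cis (2 * pi * S p * x)))\<^sup>2))
      has_integral of_nat (card ?D)) {0..1}"
    by (simp only: norm_sum_cis_sq)
  from has_integral_Re[OF this] show ?thesis by simp
qed

lemma weyl_sum_eq_cis: "weyl_sum N k x = (\<Sum>m = 1..N. cis (2 * pi * real (m ^ k) * x))"
  unfolding weyl_sum_def cis_conv_exp by (simp add: algebra_simps)

lemma continuous_on_weyl_sum [continuous_intros]: "continuous_on A (weyl_sum N k)"
  unfolding weyl_sum_def by (intro continuous_intros)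

lemma cis_sum: "cis (\<Sum>i\<in>A. f i) = (\<Prod>i\<in>A. cis (f i))"
  by (induction A rule: infinite_finite_induct) (simp_all flip: cis_mult)

text \<open>Writing each power as a product over \<open>j\<close> gives a product over the pairs
  \<open>(i, j)\<close>. Distributing it over the sums amounts to choosing one \<open>m\<close> per
  pair, that is, an extensional family as in \<open>solution_set\<close>.\<close>

lemma prod_weyl_sum_power:
  fixes l :: nat
  shows "(\<Prod>i = 1..l. weyl_sum N (k i) x ^ s i) =
   (\<Sum>p \<in> (SIGMA i:{1..l}. {1..s i}) \<rightarrow>\<^sub>E {1..N}.
      cis (2 * pi * real (\<Sum>i = 1..l. \<Sum>j = 1..s i. p (i, j) ^ k i) * x))"
proof -
  let ?I = "SIGMA i:{1..l}. {1..s i}"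
  have "(\<Prod>i = 1..l. weyl_sum N (k i) x ^ s i) = (\<Prod>i = 1..l. \<Prod>j = 1..s i. weyl_sum N (k i) x)"
    by simp
  also have "\<dots> = (\<Prod>(i, j)\<in>?I. weyl_sum N (k i) x)"
    by (intro prod.Sigma ballI finite_atLeastAtMost)
  also have "\<dots> = (\<Prod>r\<in>?I. \<Sum>m\<in>{1..N}. cis (2 * pi * real (m ^ k (fst r)) * x))"
    by (simp add: weyl_sum_eq_cis case_prod_unfold)
  also have "\<dots> = (\<Sum>p \<in> ?I \<rightarrow>\<^sub>E {1..N}. \<Prod>r\<in>?I. cis (2 * pi * real (p r ^ k (fst r)) * x))"
    by (rule prod_sum_PiE) auto
  also have "\<dots> = (\<Sum>p \<in> ?I \<rightarrow>\<^sub>E {1..N}. cis (2 * pi * real (\<Sum>r\<in>?I. p r ^ k (fst r)) * x))"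
    by (simp add: sum_distrib_left sum_distrib_right flip: cis_sum)
  finally show ?thesis
    by (simp add: sum.Sigma case_prod_unfold)
qed

lemma has_integral_num_solutions:
  "((\<lambda>x::real. \<Prod>i = 1..l. norm (weyl_sum N (k i) x) ^ (2 * s i)) has_integral
    real (num_solutions l k s N)) {0..1}"
proof -
  let ?P = "(SIGMA i:{1..l}. {1..s i}) \<rightarrow>\<^sub>E {1..N}"
  have "finite ?P" by (intro finite_PiE) auto
  from has_integral_norm_sum_cis_sq[OF this, of "\<lambda>p. \<Sum>i = 1..l. \<Sum>j = 1..s i. p (i, j) ^ k i"]
  have "((\<lambda>x::real. (norm (\<Prod>i = 1..l. weyl_sum N (k i) x ^ s i))\<^sup>2) has_integral
      real (num_solutions l k s N)) {0..1}"
    by (simp only: num_solutions_def solution_set_def prod_weyl_sum_power)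
  moreover have "(norm (\<Prod>i = 1..l. weyl_sum N (k i) x ^ s i))\<^sup>2 =
      (\<Prod>i = 1..l. norm (weyl_sum N (k i) x) ^ (2 * s i))" for x
    by (simp add: norm_power prod_power_distrib mult.commute flip: prod_norm power_mult)
  ultimately show ?thesis
    by simp
qed

text \<open>The integral of \<open>(s * u x - t * v x)\<^sup>2\<close> is a nonnegative quadratic
  form in \<open>s\<close> and \<open>t\<close>; suitable values of \<open>s\<close> and
  \<open>t\<close> give the bound.\<close>

lemma Cauchy_Schwarz_integral:
  fixes u v :: "real \<Rightarrow> real"
  assumes "continuous_on {a..b} u" "continuous_on {a..b} v"
  shows "(integral {a..b} (\<lambda>x. u x * v x))\<^sup>2 \<le>
    integral {a..b} (\<lambda>x. (u x)\<^sup>2) * integral {a..b} (\<lambda>x. (v x)\<^sup>2)"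
proof -
  define A where "A = integral {a..b} (\<lambda>x. (u x)\<^sup>2)"
  define B where "B = integral {a..b} (\<lambda>x. u x * v x)"
  define C where "C = integral {a..b} (\<lambda>x. (v x)\<^sup>2)"
  have A: "((\<lambda>x. (u x)\<^sup>2) has_integral A) {a..b}"
    and B: "((\<lambda>x. u x * v x) has_integral B) {a..b}"
    and C: "((\<lambda>x. (v x)\<^sup>2) has_integral C) {a..b}"
    unfolding A_def B_def C_def
    by (intro integrable_integral integrable_continuous_real continuous_intros assms)+
  have quad: "0 \<le> s\<^sup>2 * A - 2 * s * t * B + t\<^sup>2 * C" for s t :: real
  proof -
    have "((\<lambda>x. s\<^sup>2 * (u x)\<^sup>2 - 2 * s * t * (u x * v x) + t\<^sup>2 * (v x)\<^sup>2) has_integral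
        s\<^sup>2 * A - 2 * s * t * B + t\<^sup>2 * C) {a..b}"
      by (intro has_integral_add has_integral_diff has_integral_mult_right A B C)
    moreover have "s\<^sup>2 * (u x)\<^sup>2 - 2 * s * t * (u x * v x) + t\<^sup>2 * (v x)\<^sup>2 = (s * u x - t * v x)\<^sup>2" for x
      by (simp add: power2_eq_square algebra_simps)
    ultimately have "((\<lambda>x. (s * u x - t * v x)\<^sup>2) has_integral
        s\<^sup>2 * A - 2 * s * t * B + t\<^sup>2 * C) {a..b}"
      by (simp only:)
    then show ?thesis
      by (rule has_integral_nonneg) simp
  qed
  have "B\<^sup>2 \<le> A * C"
  proof (cases "C = 0")
    case True
    have "B = 0"
    proof (rule ccontr)
      assume "B \<noteq> 0"
      \<comment> \<open>With \<open>C = 0\<close> and \<open>s = 1\<close> the form is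
        \<open>A - 2 * t * B\<close>, and this \<open>t\<close> makes it -1.\<close>
      then show False using quad[of 1 "(A + 1) / (2 * B)"] True by simp
    qed
    then show ?thesis using True by simp
  next
    case False
    moreover have "C \<ge> 0" using quad[of 0 1] by simp
    ultimately have "C > 0" by simp
    moreover have "0 \<le> C * (A * C - B\<^sup>2)"
      \<comment> \<open>The minimising ratio \<open>s : t = C : B\<close> turns the form into
        \<open>C * (A * C - B\<^sup>2)\<close>.\<close>
      using quad[of C B] by (simp add: power2_eq_square algebra_simps)
    ultimately show ?thesis by (simp add: zero_le_mult_iff)
  qed
  then show ?thesis by (simp add: A_def B_def C_def)
qed

text \<open>Hoelder's inequality for the exponents 2, 4, ..., \<open>2 ^ n\<close>,
  \<open>2 ^ n\<close>, whose reciprocals sum to 1. The induction keeps \<open>h\<close> arbitrary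
  so that the last \<open>g\<close> can be absorbed into it.\<close>

lemma integral_prod_le_dyadic_Hoelder:
  fixes g :: "nat \<Rightarrow> real \<Rightarrow> real" and h :: "real \<Rightarrow> real"
  assumes "\<And>i. i \<in> {1..n} \<Longrightarrow> continuous_on {a..b} (g i)" "continuous_on {a..b} h"
    and "\<And>i x. i \<in> {1..n} \<Longrightarrow> g i x \<ge> 0" "\<And>x. h x \<ge> 0"
  shows "integral {a..b} (\<lambda>x. (\<Prod>i = 1..n. g i x) * h x) \<le>
    (\<Prod>i = 1..n. integral {a..b} (\<lambda>x. g i x ^ 2 ^ i) powr (1 / 2 ^ i)) *
    integral {a..b} (\<lambda>x. h x ^ 2 ^ n) powr (1 / 2 ^ n)"
  using assms
proof (induction n arbitrary: h)
  case 0
  then show ?case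
    \<comment> \<open>Here the exponent is 1, and nonnegativity of the integral removes the
      \<open>powr 1\<close>.\<close>
    by (simp add: integral_nonneg integrable_continuous_real)
next
  case (Suc n)
  let ?J = "\<lambda>m u. integral {a..b} (\<lambda>x. u x ^ 2 ^ m :: real)"
  let ?g = "g (Suc n)"
  let ?\<Pi> = "\<Prod>i = 1..n. ?J i (g i) powr (1 / 2 ^ i)"
  have J0: "?J m u \<ge> 0" if "continuous_on {a..b} u" "\<And>x. u x \<ge> 0" for m u
    using that by (intro integral_nonneg integrable_continuous_real continuous_intros) auto
  have "integral {a..b} (\<lambda>x. (\<Prod>i = 1..n. g i x) * (?g x * h x)) \<le>
      ?\<Pi> * ?J n (\<lambda>x. ?g x * h x) powr (1 / 2 ^ n)"
    using Suc.prems by (intro Suc.IH) (auto intro!: continuous_intros)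
  also have "\<dots> \<le> ?\<Pi> * (?J (Suc n) ?g * ?J (Suc n) h) powr (1 / 2 ^ Suc n)"
  proof (rule mult_left_mono)
    \<comment> \<open>Cauchy--Schwarz for the \<open>2 ^ n\<close>-th powers of the two factors;
      squaring these powers raises the exponent to \<open>2 ^ Suc n\<close>.\<close>
    have "(?J n (\<lambda>x. ?g x * h x))\<^sup>2 \<le> ?J (Suc n) ?g * ?J (Suc n) h"
      using Cauchy_Schwarz_integral[of a b "\<lambda>x. ?g x ^ 2 ^ n" "\<lambda>x. h x ^ 2 ^ n"] Suc.prems
      by (simp add: continuous_on_power power_mult_distrib mult.commute flip: power_mult)
    then have "((?J n (\<lambda>x. ?g x * h x))\<^sup>2) powr (1 / 2 ^ Suc n) \<le>
        (?J (Suc n) ?g * ?J (Suc n) h) powr (1 / 2 ^ Suc n)"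
      by (intro powr_mono2) auto
    moreover have "(t\<^sup>2) powr (1 / 2 ^ Suc n) = t powr (1 / 2 ^ n)" if "t \<ge> 0" for t :: real
    proof -
      have "t\<^sup>2 = t powr 2" using that by simp
      then show ?thesis by (simp only: powr_powr) simp
    qed
    moreover have "?J n (\<lambda>x. ?g x * h x) \<ge> 0"
      using Suc.prems by (intro J0) (auto intro!: continuous_intros)
    ultimately show "?J n (\<lambda>x. ?g x * h x) powr (1 / 2 ^ n) \<le>
        (?J (Suc n) ?g * ?J (Suc n) h) powr (1 / 2 ^ Suc n)"
      by simp
  qed (simp add: prod_nonneg)
  also have "(?J (Suc n) ?g * ?J (Suc n) h) powr (1 / 2 ^ Suc n) =
      ?J (Suc n) ?g powr (1 / 2 ^ Suc n) * ?J (Suc n) h powr (1 / 2 ^ Suc n)"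
    by (rule powr_mult)
  finally show ?case
    by (simp add: mult.assoc)
qed

theorem mainTheorem3:
  fixes l N :: nat and k s :: "nat \<Rightarrow> nat"
  assumes "l \<ge> 2" and "N \<ge> 1"
    and "\<And>i. i \<in> {1..l} \<Longrightarrow> k i \<ge> 1"
    and "inj_on k {1..l}"
    and "\<And>i. i \<in> {1..l} \<Longrightarrow> s i \<ge> 1"
  shows "real (num_solutions l k s N) =
           integral {0..1} (\<lambda>x::real. \<Prod>i = 1..l. norm (weyl_sum N (k i) x) ^ (2 * s i)) \<and>
         integral {0..1} (\<lambda>x::real. \<Prod>i = 1..l. norm (weyl_sum N (k i) x) ^ (2 * s i)) \<le>
           (\<Prod>i = 1..l - 1.
              integral {0..1} (\<lambda>x::real. norm (weyl_sum N (k i) x) ^ (2 ^ (i + 1) * s i)) powr (1 / 2 ^ i)) *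
           integral {0..1} (\<lambda>x::real. norm (weyl_sum N (k l) x) ^ (2 ^ l * s l)) powr (1 / 2 ^ (l - 1))"
proof
  show "real (num_solutions l k s N) =
      integral {0..1} (\<lambda>x::real. \<Prod>i = 1..l. norm (weyl_sum N (k i) x) ^ (2 * s i))"
    using has_integral_num_solutions by (rule integral_unique[symmetric])
  define g where "g i x = norm (weyl_sum N (k i) x) ^ (2 * s i)" for i and x :: real
  \<comment> \<open>The factor with index \<open>l\<close> plays the role of \<open>h\<close>. Hence
    its root has the same order \<open>2 ^ (l - 1)\<close> as that of the factor before it.\<close>
  obtain n where l: "l = Suc n" using assms(1) by (cases l) auto
  \<comment> \<open>The 2 in the exponent \<open>2 * s i\<close> of \<open>g\<close> shifts the
    power of two by one: \<open>m = i\<close> gives \<open>2 ^ (i + 1)\<close>, and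
    \<open>m = n\<close> gives \<open>2 ^ l\<close>.\<close>
  have pow: "g i x ^ 2 ^ m = norm (weyl_sum N (k i) x) ^ (2 ^ Suc m * s i)" for i m x
    unfolding g_def by (simp add: algebra_simps flip: power_mult)
  have "integral {0..1} (\<lambda>x. (\<Prod>i = 1..n. g i x) * g l x) \<le>
      (\<Prod>i = 1..n. integral {0..1} (\<lambda>x. g i x ^ 2 ^ i) powr (1 / 2 ^ i)) *
      integral {0..1} (\<lambda>x. g l x ^ 2 ^ n) powr (1 / 2 ^ n)"
    by (rule integral_prod_le_dyadic_Hoelder) (auto simp: g_def intro!: continuous_intros)
  then show "integral {0..1} (\<lambda>x::real. \<Prod>i = 1..l. norm (weyl_sum N (k i) x) ^ (2 * s i)) \<le>
      (\<Prod>i = 1..l - 1.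
        integral {0..1} (\<lambda>x::real. norm (weyl_sum N (k i) x) ^ (2 ^ (i + 1) * s i)) powr (1 / 2 ^ i)) *
      integral {0..1} (\<lambda>x::real. norm (weyl_sum N (k l) x) ^ (2 ^ l * s l)) powr (1 / 2 ^ (l - 1))"
    unfolding pow unfolding g_def by (simp add: l)
qed

end
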